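(* Let $a,b,c,d\in\mathbb{R}$ with $ad-bc\neq 0$, put $u=ax+by$, $v=cx+dy$, and let $M$ be the affine translation surface of Type 1 in the isotropic 3-space $\mathbb{I}^3$ parametrized by $$r(x,y)=(r_1,r_2,r_3)(x,y)=\bigl(x,\,y,\,f(u)+g(v)\bigr),$$ with $f,g$ smooth real functions of one variable. Suppose there are $\lambda_1,\lambda_2,\lambda_3\in\mathbb{R}$ such that $\bigtriangleup^{I}r_i=\lambda_ir_i$ for $i=1,2,3$. Then $M$ is congruent to one of the following surfaces, where the $c_j$ are real constants: (i) $(\lambda_1,\lambda_2,\lambda_3)=(0,0,0)$ and $$z(x,y)=c_1u^2-\frac{c_1(a^2+b^2)}{c^2+d^2}v^2+c_3u+c_4v+c_5;$$ (ii) $(\lambda_1,\lambda_2,\lambda_3)=(0,0,\lambda)$ with $\lambda>0$ and $$z(x,y)=c_1e^{\sqrt{\frac{\lambda}{a^2+b^2}}\,u}+c_2e^{-\sqrt{\frac{\lambda}{a^2+b^2}}\,u}+c_3e^{\sqrt{\frac{\lambda}{c^2+d^2}}\,v}+c_4e^{-\sqrt{\frac{\lambda}{c^2+d^2}}\,v};$$ (iii) $(\lambda_1,\lambda_2,\lambda_3)=(0,0,\lambda)$ with $\lambda<0$ and $$z(x,y)=c_1\cos\Bigl(\sqrt{\tfrac{-\lambda}{a^2+b^2}}\,u\Bigr)+c_2\sin\Bigl(\sqrt{\tfrac{-\lambda}{a^2+b^2}}\,u\Bigr)+c_3\cos\Bigl(\sqrt{\tfrac{-\lambda}{c^2+d^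2}}\,v\Bigr)+c_4\sin\Bigl(\sqrt{\tfrac{-\lambda}{c^2+d^2}}\,v\Bigr).$$
   Context: The isotropic 3-space $\mathbb{I}^3$ is the real affine 3-space with coordinates $(x,y,z)$ endowed with the degenerate metric $ds^2=dx^2+dy^2$. Its group of motions is the six-parameter group of maps $$x'=a_1+x\cos\phi-y\sin\phi,\quad y'=a_2+x\sin\phi+y\cos\phi,\quad z'=a_3+a_4x+a_5y+z,$$ with $a_1,\dots,a_5,\phi\in\mathbb{R}$; two surfaces are congruent if one is carried to the other by such a motion (in particular, equal surfaces are congruent). An affine translation surface of Type 1 is the graph of $z(x,y)=f(ax+by)+g(cx+dy)$ with $ad-bc\ne0$; the pair $(u,v)=(ax+by,cx+dy)$ is called the affine parameter coordinates. Here $f$ and $g$ are smooth functions on open intervals $I$ and $J$, and the graph is taken over $\{(x,y): ax+by\in I,\ cx+dy\in J\}$. The first fundamental form of a graph surface in $\mathbb{I}^3$ is $I=dx^2+dy^2$, and the Laplace operator with respect to $I$ is $\bigtriangleup^{I}=\frac{\partial^2}{\partial x^2}+\frac{\partial^2}{\partial y^2}$. *)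

theory Defs
  imports "HOL-Analysis.Analysis"
begin

(* Only used for open I, where the values of the iterated derivatives on I depend only on f
   restricted to I. *)
definition smooth_on :: "real set \<Rightarrow> (real \<Rightarrow> real) \<Rightarrow> bool" where
  "smooth_on I f \<longleftrightarrow> (\<forall>n. (deriv ^^ n) f differentiable_on I)"

definition isotropic_motion ::
    "real \<Rightarrow> real \<Rightarrow> real \<Rightarrow> real \<Rightarrow> real \<Rightarrow> real \<Rightarrow> real ^ 3 \<Rightarrow> real ^ 3" where
  "isotropic_motion a1 a2 a3 a4 a5 \<phi> p = vector
     [a1 + p $ 1 * cos \<phi> - p $ 2 * sin \<phi>,
      a2 + p $ 1 * sin \<phi> + p $ 2 * cos \<phi>,
      a3 + a4 * p $ 1 + a5 * p $ 2 + p $ 3]"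

definition isotropic_congruent :: "(real ^ 3) set \<Rightarrow> (real ^ 3) set \<Rightarrow> bool" where
  "isotropic_congruent S S' \<longleftrightarrow>
     (\<exists>a1 a2 a3 a4 a5 \<phi>. isotropic_motion a1 a2 a3 a4 a5 \<phi> ` S = S')"

definition affine_domain ::
    "real \<Rightarrow> real \<Rightarrow> real \<Rightarrow> real \<Rightarrow> real set \<Rightarrow> real set \<Rightarrow> (real \<times> real) set" where
  "affine_domain a b c d I J = {(x, y). a * x + b * y \<in> I \<and> c * x + d * y \<in> J}"

(* The height h is a function of the affine parameter coordinates (u, v), not of (x, y). *)
definition affine_graph_param ::
    "real \<Rightarrow> real \<Rightarrow> real \<Rightarrow> real \<Rightarrow> (real \<Rightarrow> real \<Rightarrow> real) \<Rightarrow> real \<times> real \<Rightarrow> real ^ 3" where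
  "affine_graph_param a b c d h = (\<lambda>(x, y). vector [x, y, h (a * x + b * y) (c * x + d * y)])"

definition affine_graph ::
    "real \<Rightarrow> real \<Rightarrow> real \<Rightarrow> real \<Rightarrow> real set \<Rightarrow> real set \<Rightarrow> (real \<Rightarrow> real \<Rightarrow> real) \<Rightarrow> (real ^ 3) set" where
  "affine_graph a b c d I J h = affine_graph_param a b c d h ` affine_domain a b c d I J"

(* The first fundamental form of a graph surface in isotropic space is dx^2 + dy^2, so its
   Laplace operator is the flat one in the parameters (x, y). *)
definition laplace_I :: "(real \<times> real \<Rightarrow> real) \<Rightarrow> real \<times> real \<Rightarrow> real" where
  "laplace_I F = (\<lambda>(x, y). (deriv ^^ 2) (\<lambda>s. F (s, y)) x + (deriv ^^ 2) (\<lambda>t. F (x, t)) y)"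

end

theory Submission
  imports Defs
begin

text \<open>In the coordinates \<open>(u, v)\<close> the third Laplace equation reads
  \<open>(a\<^sup>2 + b\<^sup>2) f''(u) + (c\<^sup>2 + d\<^sup>2) g''(v) = \<lambda> (f(u) + g(v))\<close>.  Since \<open>u\<close> and \<open>v\<close> vary
  independently, it separates with a constant \<open>k\<close> into
  \<open>(a\<^sup>2 + b\<^sup>2) f'' = \<lambda> f + k\<close> and \<open>(c\<^sup>2 + d\<^sup>2) g'' = \<lambda> g - k\<close>.  For \<open>\<lambda> \<noteq> 0\<close> the shifts
  \<open>f + k/\<lambda>\<close> and \<open>g - k/\<lambda>\<close> satisfy the homogeneous equations and have the same sum as
  \<open>f\<close> and \<open>g\<close>, so the surface is equal to one of the listed ones.\<close>

section \<open>Second derivatives along affine lines\<close>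

lemma smooth_on_DERIV:
  assumes "smooth_on S f" "open S" "x \<in> S"
  shows "(f has_real_derivative deriv f x) (at x)"
    and "(deriv f has_real_derivative deriv (deriv f) x) (at x)"
proof -
  have "((deriv ^^ n) f) differentiable at x" for n
    using assms unfolding smooth_on_def differentiable_on_def
    by (metis at_within_open)
  from this[of 0] this[of 1]
  show "(f has_real_derivative deriv f x) (at x)"
    and "(deriv f has_real_derivative deriv (deriv f) x) (at x)"
    by (simp_all add: DERIV_deriv_iff_real_differentiable)
qed

lemma second_deriv_sum_affine:
  fixes f g :: "real \<Rightarrow> real"
  assumes "smooth_on I f" "open I" "smooth_on J g" "open J"
    and "p * x + q \<in> I" "m * x + n \<in> J"
  shows "(deriv ^^ 2) (\<lambda>s. f (p * s + q) + g (m * s + n)) x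
    = p\<^sup>2 * deriv (deriv f) (p * x + q) + m\<^sup>2 * deriv (deriv g) (m * x + n)"
proof -
  \<comment> \<open>The chain rule is available only where both arguments stay in \<open>I\<close>
    and \<open>J\<close>. This set is an open neighbourhood of \<open>x\<close>, so the
    first-derivative formula found on it can be differentiated again at \<open>x\<close>.\<close>
  define S where "S = (\<lambda>s. p * s + q) -` I \<inter> (\<lambda>s. m * s + n) -` J"
  have S: "open S" "x \<in> S"
    unfolding S_def using assms
    by (auto intro!: open_Int open_vimage continuous_intros)
  have affine: "((\<lambda>s. p * s + q) has_real_derivative p) (at s)" for p q s :: real
    by (auto intro!: derivative_eq_intros)
  have 1: "deriv (\<lambda>s. f (p * s + q) + g (m * s + n)) s
      = p * deriv f (p * s + q) + m * deriv g (m * s + n)" if "s \<in> S" for s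
  proof (rule DERIV_imp_deriv)
    have "p * s + q \<in> I" "m * s + n \<in> J"
      using that by (auto simp: S_def)
    note D = smooth_on_DERIV(1)[OF assms(1,2) this(1)] smooth_on_DERIV(1)[OF assms(3,4) this(2)]
    show "((\<lambda>s. f (p * s + q) + g (m * s + n)) has_real_derivative
        p * deriv f (p * s + q) + m * deriv g (m * s + n)) (at s)"
      using DERIV_add[OF DERIV_chain2[OF D(1) affine] DERIV_chain2[OF D(2) affine]]
      by (simp add: mult.commute)
  qed
  note D = smooth_on_DERIV(2)[OF assms(1,2,5)] smooth_on_DERIV(2)[OF assms(3,4,6)]
  have "((\<lambda>s. p * deriv f (p * s + q) + m * deriv g (m * s + n)) has_real_derivative
      p\<^sup>2 * deriv (deriv f) (p * x + q) + m\<^sup>2 * deriv (deriv g) (m * x + n)) (at x)"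
    using DERIV_add[OF DERIV_cmult[OF DERIV_chain2[OF D(1) affine], of p]
        DERIV_cmult[OF DERIV_chain2[OF D(2) affine], of m]]
    by (simp add: power2_eq_square ac_simps)
  then have "(deriv (\<lambda>s. f (p * s + q) + g (m * s + n)) has_real_derivative
      p\<^sup>2 * deriv (deriv f) (p * x + q) + m\<^sup>2 * deriv (deriv g) (m * x + n)) (at x)"
    by (rule has_field_derivative_transform_within_open[OF _ S]) (simp add: 1)
  then show ?thesis
    by (simp add: numeral_2_eq_2 DERIV_imp_deriv)
qed

section \<open>Ordinary differential equations on an interval\<close>

lemma DERIV_zero_interval_constant:
  fixes h :: "real \<Rightarrow> real"
  assumes "is_interval S" "\<And>x. x \<in> S \<Longrightarrow> (h has_real_derivative 0) (at x)"
  shows "\<exists>k. \<forall>x\<in>S. h x = k"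
  using has_field_derivative_zero_constant[of S h] assms
  by (meson has_field_derivative_at_within is_interval_convex)

lemma ode_constant_acceleration:
  fixes f :: "real \<Rightarrow> real"
  assumes "is_interval S"
    and "\<And>x. x \<in> S \<Longrightarrow> (f has_real_derivative f' x) (at x)"
    and "\<And>x. x \<in> S \<Longrightarrow> (f' has_real_derivative k) (at x)"
  obtains p q where "\<And>x. x \<in> S \<Longrightarrow> f x = k / 2 * x\<^sup>2 + p * x + q"
proof -
  have "((\<lambda>x. f' x - k * x) has_real_derivative 0) (at x)" if "x \<in> S" for x
    using assms(3)[OF that] by (auto intro!: derivative_eq_intros)
  then obtain p where p: "f' x - k * x = p" if "x \<in> S" for x
    using DERIV_zero_interval_constant[OF assms(1), of "\<lambda>x. f' x - k * x"] by blast
  have "((\<lambda>x. f x - k / 2 * x\<^sup>2 - p * x) has_real_derivative 0) (at x)" if "x \<in> S" for x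
    using assms(2)[OF that] p[OF that] by (auto intro!: derivative_eq_intros)
  then obtain q where "f x - k / 2 * x\<^sup>2 - p * x = q" if "x \<in> S" for x
    using DERIV_zero_interval_constant[OF assms(1), of "\<lambda>x. f x - k / 2 * x\<^sup>2 - p * x"] by blast
  then show thesis
    by (intro that[of p q]) (simp add: algebra_simps)
qed

text \<open>For \<open>s = w\<close> and \<open>s = - w\<close> the function
  \<open>f' + s * f\<close> solves the first-order equation \<open>y' = s * y\<close>, so
  multiplying it by \<open>exp (- s * x)\<close> gives a constant. These two first integrals
  determine \<open>f\<close>.\<close>

lemma ode_exponential:
  fixes f :: "real \<Rightarrow> real"
  assumes "is_interval S" "w \<noteq> 0"
    and "\<And>x. x \<in> S \<Longrightarrow> (f has_real_derivative f' x) (at x)"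
    and "\<And>x. x \<in> S \<Longrightarrow> (f' has_real_derivative w\<^sup>2 * f x) (at x)"
  obtains p q where "\<And>x. x \<in> S \<Longrightarrow> f x = p * exp (w * x) + q * exp (- w * x)"
proof -
  have first_integral: "\<exists>k. \<forall>x\<in>S. (f' x + s * f x) * exp (- s * x) = k" if s: "s\<^sup>2 = w\<^sup>2" for s
  proof -
    have "((\<lambda>x. (f' x + s * f x) * exp (- s * x)) has_real_derivative 0) (at x)"
      if x: "x \<in> S" for x
    proof -
      have "((\<lambda>x. exp (- s * x)) has_real_derivative exp (- s * x) * - s) (at x)"
        by (auto intro!: derivative_eq_intros)
      from DERIV_mult[OF DERIV_add[OF assms(4)[OF x] DERIV_cmult[OF assms(3)[OF x], of s]] this]
      show ?thesis
        unfolding s[symmetric] by (rule DERIV_cong) (simp add: algebra_simps power2_eq_square)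
    qed
    then show ?thesis
      by (rule DERIV_zero_interval_constant[OF assms(1)])
  qed
  obtain P where P: "(f' x + w * f x) * exp (- w * x) = P" if "x \<in> S" for x
    using first_integral[of w] by auto
  obtain Q where Q: "(f' x - w * f x) * exp (w * x) = Q" if "x \<in> S" for x
    using first_integral[of "- w"] by auto
  show thesis
  proof (rule that[of "P / (2 * w)" "- Q / (2 * w)"])
    fix x assume x: "x \<in> S"
    have E: "exp (w * x) * exp (- w * x) = 1"
      by (simp flip: exp_add)
    have "P * exp (w * x) = f' x + w * f x" "Q * exp (- w * x) = f' x - w * f x"
      unfolding P[OF x, symmetric] Q[OF x, symmetric] using E by (simp_all add: mult.assoc mult.commute)
    \<comment> \<open>Subtracting eliminates \<open>f'\<close>, and dividing by \<open>2 * w\<close>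
      explains the coefficients chosen above.\<close>
    then have "P * exp (w * x) - Q * exp (- w * x) = 2 * w * f x"
      by simp
    then show "f x = P / (2 * w) * exp (w * x) + - Q / (2 * w) * exp (- w * x)"
      using assms(2) by (simp add: field_simps)
  qed
qed

text \<open>The vector \<open>(f, f' / w)\<close> rotates clockwise through the angle
  \<open>w * x\<close>. Turning it back through that angle gives the conserved pair
  \<open>?P\<close>, \<open>?Q\<close>, whose constant values are the two coefficients.\<close>

lemma ode_harmonic:
  fixes f :: "real \<Rightarrow> real"
  assumes "is_interval S" "w \<noteq> 0"
    and "\<And>x. x \<in> S \<Longrightarrow> (f has_real_derivative f' x) (at x)"
    and "\<And>x. x \<in> S \<Longrightarrow> (f' has_real_derivative - w\<^sup>2 * f x) (at x)"
  obtains p q where "\<And>x. x \<in> S \<Longrightarrow> f x = p * cos (w * x) + q * sin (w * x)"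
proof -
  let ?P = "\<lambda>x. f x * cos (w * x) - f' x / w * sin (w * x)"
  let ?Q = "\<lambda>x. f x * sin (w * x) + f' x / w * cos (w * x)"
  have D: "(?P has_real_derivative 0) (at x)" "(?Q has_real_derivative 0) (at x)" if x: "x \<in> S" for x
  proof -
    note F = assms(3)[OF x] DERIV_cdivide[OF assms(4)[OF x], of w]
    have C: "((\<lambda>x. cos (w * x)) has_real_derivative - sin (w * x) * w) (at x)"
      and S: "((\<lambda>x. sin (w * x)) has_real_derivative cos (w * x) * w) (at x)"
      by (auto intro!: derivative_eq_intros)
    show "(?P has_real_derivative 0) (at x)"
      using DERIV_diff[OF DERIV_mult[OF F(1) C] DERIV_mult[OF F(2) S]] assms(2)
      by (simp add: field_simps power2_eq_square)
    show "(?Q has_real_derivative 0) (at x)"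
      using DERIV_add[OF DERIV_mult[OF F(1) S] DERIV_mult[OF F(2) C]] assms(2)
      by (simp add: field_simps power2_eq_square)
  qed
  have "\<exists>P. \<forall>x\<in>S. ?P x = P" "\<exists>Q. \<forall>x\<in>S. ?Q x = Q"
    by (rule DERIV_zero_interval_constant[OF assms(1)], erule D)+
  then obtain P Q where PQ: "?P x = P" "?Q x = Q" if "x \<in> S" for x
    by blast
  show thesis
  proof (rule that[of P Q])
    fix x assume x: "x \<in> S"
    have "?P x * cos (w * x) + ?Q x * sin (w * x)
        = f x * (cos (w * x))\<^sup>2 + f x * (sin (w * x))\<^sup>2"
      by (simp add: algebra_simps power2_eq_square)
    also have "\<dots> = f x"
      by (simp flip: distrib_left)
    finally show "f x = P * cos (w * x) + Q * sin (w * x)"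
      using PQ[OF x] by simp
  qed
qed

section \<open>Graphs, affine coordinates and the Laplace operator\<close>

lemma isotropic_congruent_refl: "isotropic_congruent S S"
proof -
  have "isotropic_motion 0 0 0 0 0 0 = id"
    by (auto simp: isotropic_motion_def fun_eq_iff vec_eq_iff forall_3)
  then show ?thesis
    unfolding isotropic_congruent_def by (metis image_id id_apply)
qed

lemma affine_graph_cong:
  assumes "\<And>u v. u \<in> I \<Longrightarrow> v \<in> J \<Longrightarrow> h u v = h' u v"
  shows "affine_graph a b c d I J h = affine_graph a b c d I J h'"
  unfolding affine_graph_def
  by (rule image_cong) (auto simp: affine_graph_param_def affine_domain_def assms)

text \<open>Cramer's rule supplies the witnesses. The lemma is what lets \<open>u\<close> and
  \<open>v\<close> be chosen independently in \<open>I\<close> and \<open>J\<close>.\<close>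

lemma affine_coordinates_surj:
  fixes a b c d u v :: real
  assumes "a * d - b * c \<noteq> 0"
  obtains x y where "a * x + b * y = u" "c * x + d * y = v"
proof (rule that)
  let ?D = "a * d - b * c"
  have "a * ((d * u - b * v) / ?D) + b * ((a * v - c * u) / ?D) = (?D * u) / ?D"
    "c * ((d * u - b * v) / ?D) + d * ((a * v - c * u) / ?D) = (?D * v) / ?D"
    by (simp_all add: algebra_simps flip: add_divide_distrib diff_divide_distrib)
  then show "a * ((d * u - b * v) / ?D) + b * ((a * v - c * u) / ?D) = u"
    "c * ((d * u - b * v) / ?D) + d * ((a * v - c * u) / ?D) = v"
    using assms by simp_all
qed

text \<open>A single such point suffices to force the first two eigenvalues to vanish. It exists
  because a nonempty open set in the plane contains a box, each side of which contains a nonzero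
  number.\<close>

lemma affine_domain_nonzero_coordinates:
  fixes a b c d :: real
  assumes "a * d - b * c \<noteq> 0" "open I" "I \<noteq> {}" "open J" "J \<noteq> {}"
  obtains x y where "(x, y) \<in> affine_domain a b c d I J" "x \<noteq> 0" "y \<noteq> 0"
proof -
  let ?D = "affine_domain a b c d I J"
  have "?D = (\<lambda>p. a * fst p + b * snd p) -` I \<inter> (\<lambda>p. c * fst p + d * snd p) -` J"
    by (auto simp: affine_domain_def)
  then have "open ?D"
    using assms by (auto intro!: open_Int open_vimage continuous_intros)
  moreover obtain u v where "u \<in> I" "v \<in> J"
    using assms by auto
  moreover from affine_coordinates_surj[OF assms(1), of u v]
  obtain x y where "a * x + b * y = u" "c * x + d * y = v" .
  ultimately have "open ?D" "(x, y) \<in> ?D"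
    by (simp_all add: affine_domain_def)
  then obtain A B where AB: "open A" "open B" "x \<in> A" "y \<in> B" "A \<times> B \<subseteq> ?D"
    by (elim open_prod_elim) auto
  have "\<exists>z\<in>X. z \<noteq> 0" if "open X" "w \<in> X" for X :: "real set" and w
    using not_open_singleton[of "0 :: real"] that by (metis singleton_iff subset_singletonD subsetI empty_iff)
  then obtain x' y' where "x' \<in> A" "x' \<noteq> 0" "y' \<in> B" "y' \<noteq> 0"
    using AB by meson
  then show thesis
    using AB(5) by (intro that[of x' y']) auto
qed

text \<open>The gradients of \<open>u\<close> and \<open>v\<close> are the constant vectors
  \<open>(a, b)\<close> and \<open>(c, d)\<close>, so each second derivative is scaled by a squared
  gradient length. No mixed term arises because \<open>f\<close> and \<open>g\<close> are
  added.\<close>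

lemma laplace_I_affine_sum:
  assumes "smooth_on I f" "open I" "smooth_on J g" "open J"
    and "(x, y) \<in> affine_domain a b c d I J"
  shows "laplace_I (\<lambda>(x, y). f (a * x + b * y) + g (c * x + d * y)) (x, y)
    = (a\<^sup>2 + b\<^sup>2) * deriv (deriv f) (a * x + b * y) + (c\<^sup>2 + d\<^sup>2) * deriv (deriv g) (c * x + d * y)"
proof -
  \<comment> \<open>The swapped sums match the pattern \<open>p * x + q\<close> when
    \<open>y\<close> is the variable being differentiated.\<close>
  have "a * x + b * y \<in> I" "c * x + d * y \<in> J" "b * y + a * x \<in> I" "d * y + c * x \<in> J"
    using assms(5) by (simp_all add: affine_domain_def add.commute)
  then show ?thesis
    using second_deriv_sum_affine[OF assms(1-4), of a x "b * y" c "d * y"]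
      second_deriv_sum_affine[OF assms(1-4), of b y "a * x" d "c * x"]
    by (simp add: laplace_I_def algebra_simps)
qed

section \<open>Separation of variables and the three signs of the eigenvalue\<close>

theorem theorem4p1:
  fixes a b c d :: real and I J :: "real set" and f g :: "real \<Rightarrow> real"
    and \<Lambda> :: "real ^ 3" and r :: "real \<times> real \<Rightarrow> real ^ 3" and M :: "(real ^ 3) set"
  assumes "a * d - b * c \<noteq> 0"
    and "open I" "is_interval I" "I \<noteq> {}"
    and "open J" "is_interval J" "J \<noteq> {}"
    and "smooth_on I f" "smooth_on J g"
    and "r = affine_graph_param a b c d (\<lambda>u v. f u + g v)"
    and "M = r ` affine_domain a b c d I J"
    and "\<forall>i. \<forall>p \<in> affine_domain a b c d I J. laplace_I (\<lambda>q. r q $ i) p = \<Lambda> $ i * r p $ i"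
  shows
    "(\<Lambda> = vector [0, 0, 0] \<and>
        (\<exists>c1 c3 c4 c5. isotropic_congruent M (affine_graph a b c d I J
          (\<lambda>u v. c1 * u\<^sup>2 - c1 * (a\<^sup>2 + b\<^sup>2) / (c\<^sup>2 + d\<^sup>2) * v\<^sup>2 + c3 * u + c4 * v + c5)))) \<or>
     (\<exists>l>0. \<Lambda> = vector [0, 0, l] \<and>
        (\<exists>c1 c2 c3 c4. isotropic_congruent M (affine_graph a b c d I J
          (\<lambda>u v. c1 * exp (sqrt (l / (a\<^sup>2 + b\<^sup>2)) * u) + c2 * exp (- sqrt (l / (a\<^sup>2 + b\<^sup>2)) * u)
               + c3 * exp (sqrt (l / (c\<^sup>2 + d\<^sup>2)) * v) + c4 * exp (- sqrt (l / (c\<^sup>2 + d\<^sup>2)) * v))))) \<or>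
     (\<exists>l<0. \<Lambda> = vector [0, 0, l] \<and>
        (\<exists>c1 c2 c3 c4. isotropic_congruent M (affine_graph a b c d I J
          (\<lambda>u v. c1 * cos (sqrt (- l / (a\<^sup>2 + b\<^sup>2)) * u) + c2 * sin (sqrt (- l / (a\<^sup>2 + b\<^sup>2)) * u)
               + c3 * cos (sqrt (- l / (c\<^sup>2 + d\<^sup>2)) * v) + c4 * sin (sqrt (- l / (c\<^sup>2 + d\<^sup>2)) * v)))))"
proof -
  let ?A = "a\<^sup>2 + b\<^sup>2" and ?B = "c\<^sup>2 + d\<^sup>2" and ?l = "\<Lambda> $ 3"
  have A: "?A > 0" and B: "?B > 0"
    using assms(1) by (auto simp: sum_power2_gt_zero_iff)
  note r = \<open>r = _\<close> and laplace = assms(12)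
  obtain x0 y0 where dom0: "(x0, y0) \<in> affine_domain a b c d I J" and "x0 \<noteq> 0" "y0 \<noteq> 0"
    using affine_domain_nonzero_coordinates assms(1,2,4,5,7) by metis
  \<comment> \<open>The first two components are affine, hence harmonic, so at the chosen point the
    hypothesis gives \<open>\<Lambda> $ 1 * x0 = 0\<close> and
    \<open>\<Lambda> $ 2 * y0 = 0\<close>.\<close>
  moreover have "laplace_I (\<lambda>q. r q $ 1) p = 0" "laplace_I (\<lambda>q. r q $ 2) p = 0" for p
    by (simp_all add: r affine_graph_param_def laplace_I_def numeral_2_eq_2 split: prod.splits)
  ultimately have "\<Lambda> $ 1 = 0" "\<Lambda> $ 2 = 0"
    using laplace[rule_format, OF dom0, of 1] laplace[rule_format, OF dom0, of 2]
    by (simp_all add: r affine_graph_param_def)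
  then have \<Lambda>: "\<Lambda> = vector [0, 0, ?l]"
    by (simp add: vec_eq_iff forall_3)
  have pde: "?A * deriv (deriv f) u + ?B * deriv (deriv g) v = ?l * (f u + g v)"
    if "u \<in> I" "v \<in> J" for u v
  proof -
    obtain x y where xy: "a * x + b * y = u" "c * x + d * y = v"
      using affine_coordinates_surj[OF assms(1)] .
    then have dom: "(x, y) \<in> affine_domain a b c d I J"
      using that by (simp add: affine_domain_def)
    have "(\<lambda>q. r q $ 3) = (\<lambda>(x, y). f (a * x + b * y) + g (c * x + d * y))"
      by (auto simp: r affine_graph_param_def)
    then show ?thesis
      using laplace[rule_format, OF dom, of 3] xy
        laplace_I_affine_sum[OF assms(8,2,9,5) dom]
      by (simp add: r affine_graph_param_def)
  qed
  obtain v0 where v0: "v0 \<in> J"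
    using assms(7) by auto
  \<comment> \<open>This separation constant comes from fixing \<open>v = v0\<close> in
    \<open>pde\<close>, which yields the equation for \<open>f\<close>. Comparing \<open>pde\<close>
    at \<open>(u0, v)\<close> and \<open>(u0, v0)\<close> then yields the equation for
    \<open>g\<close> with the same constant.\<close>
  define k where "k = ?l * g v0 - ?B * deriv (deriv g) v0"
  have f2: "deriv (deriv f) u = (?l * f u + k) / ?A" if "u \<in> I" for u
    using pde[OF that v0] A by (auto simp: k_def eq_divide_eq algebra_simps)
  have g2: "deriv (deriv g) v = (?l * g v - k) / ?B" if "v \<in> J" for v
  proof -
    obtain u0 where u0: "u0 \<in> I"
      using assms(4) by auto
    show ?thesis
      using pde[OF u0 that] pde[OF u0 v0] B by (auto simp: k_def eq_divide_eq algebra_simps)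
  qed
  note Df = smooth_on_DERIV[OF assms(8,2)] and Dg = smooth_on_DERIV[OF assms(9,5)]
  \<comment> \<open>Congruence is obtained here as equality of surfaces: a height that agrees with
    \<open>f u + g v\<close> on \<open>I\<close> and \<open>J\<close> gives the same graph.\<close>
  have congruent: "isotropic_congruent M (affine_graph a b c d I J h)"
    if "\<And>u v. u \<in> I \<Longrightarrow> v \<in> J \<Longrightarrow> f u + g v = h u v" for h
  proof -
    have "M = affine_graph a b c d I J h"
      using affine_graph_cong[of I J "\<lambda>u v. f u + g v" h] that assms(11)
      by (simp add: r affine_graph_def)
    then show ?thesis
      by (simp add: isotropic_congruent_refl)
  qed
  have shift: "(?l * y + k) / B = ?l / B * (y + k / ?l)" "(?l * y - k) / B = ?l / B * (y - k / ?l)"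
    if "?l \<noteq> 0" for y B
    using that by (simp_all add: algebra_simps add_divide_distrib diff_divide_distrib)
  consider "?l = 0" | "?l > 0" | "?l < 0"
    by linarith
  then show ?thesis
  proof cases
    case 1
    obtain p q where f: "f u = k / ?A / 2 * u\<^sup>2 + p * u + q" if "u \<in> I" for u
      using ode_constant_acceleration[OF assms(3), of f "deriv f" "k / ?A"] Df f2 1 by auto
    obtain p' q' where g: "g v = - k / ?B / 2 * v\<^sup>2 + p' * v + q'" if "v \<in> J" for v
      using ode_constant_acceleration[OF assms(6), of g "deriv g" "- k / ?B"] Dg g2 1 by auto
    \<comment> \<open>This is the leading coefficient of \<open>f\<close>. The identity
      \<open>c\<close> rewrites the coefficient required for \<open>v\<^sup>2\<close> into the one
      found for \<open>g\<close>, and so ties the two together.\<close>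
    let ?c = "k / ?A / 2"
    have c: "?c * ?A / ?B = k / ?B / 2"
    proof -
      have "k / \<alpha> / 2 * \<alpha> / \<beta> = k / \<beta> / 2" if "\<alpha> > 0" for \<alpha> \<beta> :: real
        using that by simp
      then show ?thesis
        using A .
    qed
    have "isotropic_congruent M (affine_graph a b c d I J
        (\<lambda>u v. ?c * u\<^sup>2 - ?c * ?A / ?B * v\<^sup>2 + p * u + p' * v + (q + q')))"
      unfolding c by (rule congruent) (simp add: f g)
    moreover have "\<Lambda> = vector [0, 0, 0]"
      using \<Lambda> unfolding 1 .
    ultimately show ?thesis
      by blast
  next
    case 2
    \<comment> \<open>The shift leaves the first derivative unchanged, and \<open>?l > 0\<close>
      makes the squared root equal to \<open>?l / ?A\<close>, as \<open>ode_exponential\<close>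
      requires.\<close>
    have shifted:
      "((\<lambda>x. f x + k / ?l) has_real_derivative deriv f x) (at x)"
      "(deriv f has_real_derivative (sqrt (?l / ?A))\<^sup>2 * (f x + k / ?l)) (at x)" if "x \<in> I" for x
      using Df[OF that] f2[OF that] 2 A by (auto intro!: derivative_eq_intros simp: shift)
    have shifted':
      "((\<lambda>x. g x - k / ?l) has_real_derivative deriv g x) (at x)"
      "(deriv g has_real_derivative (sqrt (?l / ?B))\<^sup>2 * (g x - k / ?l)) (at x)" if "x \<in> J" for x
      using Dg[OF that] g2[OF that] 2 B by (auto intro!: derivative_eq_intros simp: shift)
    have w: "sqrt (?l / ?A) \<noteq> 0" "sqrt (?l / ?B) \<noteq> 0"
      using 2 A B by auto
    obtain p q where f:
      "f u + k / ?l = p * exp (sqrt (?l / ?A) * u) + q * exp (- sqrt (?l / ?A) * u)" if "u \<in> I" for u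
      using ode_exponential[OF assms(3) w(1) shifted] by blast
    obtain p' q' where g:
      "g v - k / ?l = p' * exp (sqrt (?l / ?B) * v) + q' * exp (- sqrt (?l / ?B) * v)" if "v \<in> J" for v
      using ode_exponential[OF assms(6) w(2) shifted'] by blast
    have "isotropic_congruent M (affine_graph a b c d I J
          (\<lambda>u v. p * exp (sqrt (?l / ?A) * u) + q * exp (- sqrt (?l / ?A) * u)
               + p' * exp (sqrt (?l / ?B) * v) + q' * exp (- sqrt (?l / ?B) * v)))"
    proof (rule congruent)
      \<comment> \<open>Adding the two solutions cancels \<open>k / ?l\<close>, so no constant term
        remains in the height.\<close>
      fix u v assume "u \<in> I" "v \<in> J"
      from f[OF this(1)] g[OF this(2)]
      show "f u + g v = p * exp (sqrt (?l / ?A) * u) + q * exp (- sqrt (?l / ?A) * u)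
               + p' * exp (sqrt (?l / ?B) * v) + q' * exp (- sqrt (?l / ?B) * v)"
        by linarith
    qed
    then show ?thesis
      using \<Lambda> 2 by blast
  next
    case 3
    \<comment> \<open>Since \<open>?l < 0\<close>, the factor \<open>?l / ?A\<close> is minus the
      square of the real frequency \<open>sqrt (- ?l / ?A)\<close>, so the shifted functions
      oscillate.\<close>
    have shifted:
      "((\<lambda>x. f x + k / ?l) has_real_derivative deriv f x) (at x)"
      "(deriv f has_real_derivative - (sqrt (- ?l / ?A))\<^sup>2 * (f x + k / ?l)) (at x)" if "x \<in> I" for x
      using Df[OF that] f2[OF that] 3 A by (auto intro!: derivative_eq_intros simp: shift divide_le_0_iff)
    have shifted':
      "((\<lambda>x. g x - k / ?l) has_real_derivative deriv g x) (at x)"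
      "(deriv g has_real_derivative - (sqrt (- ?l / ?B))\<^sup>2 * (g x - k / ?l)) (at x)" if "x \<in> J" for x
      using Dg[OF that] g2[OF that] 3 B by (auto intro!: derivative_eq_intros simp: shift divide_le_0_iff)
    have w: "sqrt (- ?l / ?A) \<noteq> 0" "sqrt (- ?l / ?B) \<noteq> 0"
      using 3 A B by auto
    obtain p q where f:
      "f u + k / ?l = p * cos (sqrt (- ?l / ?A) * u) + q * sin (sqrt (- ?l / ?A) * u)" if "u \<in> I" for u
      using ode_harmonic[OF assms(3) w(1) shifted] by blast
    obtain p' q' where g:
      "g v - k / ?l = p' * cos (sqrt (- ?l / ?B) * v) + q' * sin (sqrt (- ?l / ?B) * v)" if "v \<in> J" for v
      using ode_harmonic[OF assms(6) w(2) shifted'] by blast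
    have "isotropic_congruent M (affine_graph a b c d I J
          (\<lambda>u v. p * cos (sqrt (- ?l / ?A) * u) + q * sin (sqrt (- ?l / ?A) * u)
               + p' * cos (sqrt (- ?l / ?B) * v) + q' * sin (sqrt (- ?l / ?B) * v)))"
    proof (rule congruent)
      fix u v assume "u \<in> I" "v \<in> J"
      from f[OF this(1)] g[OF this(2)]
      show "f u + g v = p * cos (sqrt (- ?l / ?A) * u) + q * sin (sqrt (- ?l / ?A) * u)
               + p' * cos (sqrt (- ?l / ?B) * v) + q' * sin (sqrt (- ?l / ?B) * v)"
        by linarith
    qed
    then show ?thesis
      using \<Lambda> 3 by blast
  qed
qed

end
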